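(* Let $\Gamma$ be a finite set with $|\Gamma|\geq 2$, let $r\geq 2$, and let $W=\mathrm{Sym}(\Gamma)\wr S_r$ act on $\Omega=\Gamma^r$ in product action. If $H$ is a transitive nonabelian characteristically simple subgroup of $W$, then $H$ is contained in the base group, that is, $H\leq \mathrm{Sym}(\Gamma)^r$.
   Context: A finite group is characteristically simple if its only $\mathrm{Aut}$-invariant subgroups are $1$ and itself; equivalently it is a direct product of pairwise isomorphic simple groups. In the product action of $W=\mathrm{Sym}(\Gamma)\wr S_r$ on $\Gamma^r$, an element $(a_1,\ldots,a_r)b$ with $a_i\in\mathrm{Sym}(\Gamma)$ and $b\in S_r$ maps $(\gamma_1,\ldots,\gamma_r)$ to $(\gamma_{1b^{-1}}a_{1b^{-1}},\ldots,\gamma_{rb^{-1}}a_{rb^{-1}})$; the base group is $\mathrm{Sym}(\Gamma)^r$, the kernel of the natural projection $W\to S_r$. *)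

theory Defs
  imports "HOL-Algebra.Algebra" "HOL-Combinatorics.Permutations"
begin

definition Omega :: "'a set \<Rightarrow> nat \<Rightarrow> (nat \<Rightarrow> 'a) set" where
  "Omega \<Gamma> r = PiE {..<r} (\<lambda>_. \<Gamma>)"

text \<open>Permutation of Omega induced by (a_1,...,a_r) b in the product action:
  coordinate i of the image is a_{i b^-1} applied to coordinate i b^-1.\<close>
definition prod_act :: "'a set \<Rightarrow> nat \<Rightarrow> (nat \<Rightarrow> 'a \<Rightarrow> 'a) \<Rightarrow> (nat \<Rightarrow> nat)
    \<Rightarrow> (nat \<Rightarrow> 'a) \<Rightarrow> (nat \<Rightarrow> 'a)" where
  "prod_act \<Gamma> r a b = (\<lambda>\<omega> \<in> Omega \<Gamma> r. \<lambda>i \<in> {..<r}. a (inv_into UNIV b i) (\<omega> (inv_into UNIV b i)))"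

definition wreath_prod :: "'a set \<Rightarrow> nat \<Rightarrow> ((nat \<Rightarrow> 'a) \<Rightarrow> (nat \<Rightarrow> 'a)) set" where
  "wreath_prod \<Gamma> r = {prod_act \<Gamma> r a b | a b. (\<forall>i<r. a i permutes \<Gamma>) \<and> b permutes {..<r}}"

definition base_group :: "'a set \<Rightarrow> nat \<Rightarrow> ((nat \<Rightarrow> 'a) \<Rightarrow> (nat \<Rightarrow> 'a)) set" where
  "base_group \<Gamma> r = {prod_act \<Gamma> r a id | a. \<forall>i<r. a i permutes \<Gamma>}"

definition char_simple :: "('g, 'b) monoid_scheme \<Rightarrow> bool" where
  "char_simple G \<longleftrightarrow> group G \<and>
     (\<forall>N. subgroup N G \<and> (\<forall>\<phi> \<in> auto G. \<phi> ` N = N) \<longrightarrow>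
          N = {\<one>\<^bsub>G\<^esub>} \<or> N = carrier G)"

end

theory Submission
  imports Defs
begin

text \<open>
  A normal subgroup \<open>N\<close> of a finite nonabelian characteristically simple group \<open>H\<close> is a direct
  factor, with complement its centraliser. Suppose that \<open>H\<close> has an orbit \<open>\<Delta>\<close> on the coordinates
  with \<open>d = |\<Delta>| \<ge> 2\<close>. Let \<open>C\<close> be a complement in \<open>H\<close> of the kernel on \<open>\<Gamma>\<^sup>\<Delta>\<close>, and let \<open>P\<close> be the
  subgroup of \<open>C\<close> that fixes each coordinate in \<open>\<Delta>\<close>. The centraliser of \<open>P\<close> is transitive on
  \<open>\<Delta>\<close>, so \<open>P\<close> acts in the same way on all coordinates of \<open>\<Delta>\<close>. Since \<open>P\<close> is normal in a
  transitive group, all its orbits on \<open>\<Gamma>\<^sup>\<Delta>\<close> are as small as those of diagonal tuples, which forces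
  \<open>P\<close> to be semiregular on \<open>\<Gamma>\<close>. Therefore \<open>|P|\<close> divides \<open>|\<Gamma>|\<close>, and \<open>|\<Gamma>|^d\<close> divides \<open>|C|\<close>, which
  divides \<open>d! |P|\<close>. By Legendre's bound on the prime powers dividing \<open>d!\<close>, the group \<open>P\<close> is a
  nontrivial 2-group, contradicting that it has trivial centre.
\<close>

section \<open>Prime powers dividing factorials\<close>

text \<open>Recursive form of Legendre's formula: among 1, ..., \<open>n\<close> only the multiples
  of \<open>p\<close> contribute, each gives one factor \<open>p\<close>, and their cofactors
  multiply to \<open>fact (n div p)\<close>.\<close>

lemma multiplicity_fact_div:
  fixes p n :: nat
  assumes p: "Factorial_Ring.prime p"
  shows "multiplicity p (fact n) = n div p + multiplicity p (fact (n div p))"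
proof (induction n)
  case 0
  then show ?case by simp
next
  case (Suc n)
  have S: "multiplicity p (fact (Suc k)) = multiplicity p (Suc k) + multiplicity p (fact k)" for k
    using p by (simp add: prime_elem_multiplicity_mult_distrib del: mult_Suc of_nat_Suc)
  show ?case
  proof (cases "p dvd Suc n")
    case True
    then have d: "Suc n div p = Suc (n div p)"
      using p by (simp add: div_Suc dvd_eq_mod_eq_0)
    have "Suc n = p * Suc (n div p)"
      using True d by (metis dvd_mult_div_cancel)
    then have "multiplicity p (Suc n) = Suc (multiplicity p (Suc (n div p)))"
      using p by (simp only:) (rule multiplicity_times_same, auto)
    then show ?thesis
      using Suc.IH S[of n] S[of "n div p"] d by simp
  next
    case False
    then have "Suc n div p = n div p"
      by (simp add: div_Suc dvd_eq_mod_eq_0)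
    then show ?thesis
      using Suc.IH S[of n] False by (simp add: not_dvd_imp_multiplicity_0 del: fact_Suc)
  qed
qed

text \<open>Legendre's bound. With \<open>q = n div p\<close>, the recursion and the induction
  hypothesis for \<open>q\<close> bound the left side strictly by
  \<open>(p - 1) * q + q = p * q\<close>.\<close>

lemma multiplicity_fact_less:
  fixes p n :: nat
  assumes p: "Factorial_Ring.prime p" and n: "n > 0"
  shows "(p - 1) * multiplicity p (fact n) < n"
  using n
proof (induction n rule: less_induct)
  case (less n)
  have p2: "p \<ge> 2" using p by (rule prime_ge_2_nat)
  define q where "q = n div p"
  have v: "multiplicity p (fact n) = q + multiplicity p (fact q)"
    unfolding q_def by (rule multiplicity_fact_div[OF p])
  show ?case
  proof (cases "q = 0")
    case True
    then show ?thesis using v less.prems by simp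
  next
    case False
    have "q < n" using p2 less.prems by (simp add: q_def)
    then have "(p - 1) * multiplicity p (fact q) < q" using less.IH False by simp
    then have "(p - 1) * multiplicity p (fact n) < (p - 1) * q + q"
      using v by (simp add: distrib_left)
    also have "\<dots> = p * q" using p2 by (cases p) auto
    also have "\<dots> \<le> n" by (simp add: q_def)
    finally show ?thesis .
  qed
qed

text \<open>To be used with \<open>c\<close> the size of the component set, \<open>d\<close> the
  number of coordinates and \<open>m\<close> the order of \<open>P\<close>. Comparing multiplicities
  of a prime divisor of \<open>c\<close>, Legendre's bound excludes odd primes, and for the prime 2
  it leaves a positive share to \<open>m\<close>.\<close>

lemma power_dvd_fact_mult_imp_power_2:
  fixes c d m :: nat
  assumes c: "c \<ge> 2" and d: "d \<ge> 2" and dvd: "c ^ d dvd fact d * m" and m: "m dvd c"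
  shows "\<exists>f>0. m = 2 ^ f"
proof -
  have c0: "c \<noteq> 0" and m0: "m \<noteq> 0" using c m dvd_pos_nat[of c m] by auto
  have ineq: "d * multiplicity p c \<le> multiplicity p (fact d) + multiplicity p m" if "Factorial_Ring.prime p" for p
  proof -
    have "multiplicity p (c ^ d) \<le> multiplicity p (fact d * m)"
      using dvd m0 by (intro dvd_imp_multiplicity_le) auto
    then show ?thesis
      using that c0 m0
      by (simp add: prime_elem_multiplicity_power_distrib prime_elem_multiplicity_mult_distrib)
  qed
  have le: "multiplicity p m \<le> multiplicity p c" for p
    using m c0 by (rule dvd_imp_multiplicity_le)
  have only2: "p = 2" if p: "Factorial_Ring.prime p" "p dvd c" for p
  proof (rule ccontr)
    assume "p \<noteq> 2"
    with p have p3: "p \<ge> 3" using prime_ge_2_nat[of p] by simp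
    let ?e = "multiplicity p c"
    have e: "?e > 0" using p c0 by (subst prime_multiplicity_gt_zero_iff) auto
    have "2 * multiplicity p (fact d) \<le> (p - 1) * multiplicity p (fact d)"
      using p3 by (intro mult_right_mono) auto
    also have "\<dots> < d" using multiplicity_fact_less[OF p(1), of d] d by simp
    finally have l: "2 * multiplicity p (fact d) < d" .
    obtain k where k: "d = Suc k" "k \<ge> 1" using d by (cases d) auto
    \<comment> \<open>One of the \<open>d\<close> copies of \<open>?e\<close> absorbs
      \<open>multiplicity p m\<close>, which leaves \<open>k = d - 1\<close> copies. With
      \<open>l\<close> this gives 2k < k + 1, although k is at least 1.\<close>
    have "k * ?e \<le> multiplicity p (fact d)"
      using ineq[OF p(1)] le[of p] k by simp
    moreover have "k \<le> k * ?e" using e by simp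
    ultimately show False using l k by linarith
  qed
  obtain p where p: "Factorial_Ring.prime p" "p dvd c" using c prime_factor_nat[of c] by auto
  have two: "2 dvd c" using p only2 by blast
  have "multiplicity 2 c > 0" using two c0 by (subst prime_multiplicity_gt_zero_iff) auto
  then have "d \<le> d * multiplicity 2 c" by simp
  moreover have "multiplicity (2::nat) (fact d) < d" using multiplicity_fact_less[of 2 d] d by simp
  ultimately have f: "multiplicity 2 m > 0" using ineq[OF two_is_prime_nat] by linarith
  obtain n where n: "m = 2 ^ multiplicity 2 m * n" "\<not> 2 dvd n"
    using multiplicity_decompose'[of m 2] m0 by auto
  have "n = 1"
  proof (rule ccontr)
    assume "n \<noteq> 1"
    then obtain q where q: "Factorial_Ring.prime q" "q dvd n" using prime_factor_nat by blast
    then have "q dvd c" using n(1) m dvd_trans[OF dvd_mult] by metis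
    then show False using only2 q n(2) by blast
  qed
  then have "m = 2 ^ multiplicity 2 m" using n(1) by simp
  then show ?thesis using f by blast
qed

section \<open>Orbit counting\<close>

context group
begin

text \<open>Orbit-stabiliser counting for a map instead of an action: by \<open>eqv\<close>, left
  multiplication by \<open>k\<close> carries fibres to fibres, so every fibre is a translate of the
  one through \<open>\<one>\<close>. It serves both for orbit maps and for a homomorphism.\<close>

lemma card_eq_card_image_mult_fibre:
  assumes fin: "finite (carrier G)"
    and eqv: "\<And>k g h. k \<in> carrier G \<Longrightarrow> g \<in> carrier G \<Longrightarrow> h \<in> carrier G \<Longrightarrow> f g = f h \<Longrightarrow> f (k \<otimes> g) = f (k \<otimes> h)"
  shows "order G = card (f ` carrier G) * card {g \<in> carrier G. f g = f \<one>}"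
proof -
  have eq: "card {g \<in> carrier G. f g = y} = card {g \<in> carrier G. f g = f \<one>}"
    if "y \<in> f ` carrier G" for y
  proof -
    from that obtain k where k: "k \<in> carrier G" "y = f k" by blast
    have "bij_betw (\<lambda>g. k \<otimes> g) {g \<in> carrier G. f g = f \<one>} {g \<in> carrier G. f g = y}"
    proof (rule bij_betw_byWitness[where f' = "\<lambda>g. inv k \<otimes> g"])
      show "(\<otimes>) k ` {g \<in> carrier G. f g = f \<one>} \<subseteq> {g \<in> carrier G. f g = y}"
        using k eqv[of k _ \<one>] by auto
      show "(\<otimes>) (inv k) ` {g \<in> carrier G. f g = y} \<subseteq> {g \<in> carrier G. f g = f \<one>}"
        using k eqv[of "inv k" _ k] by auto
    qed (use k in \<open>auto simp: m_assoc[symmetric]\<close>)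
    from bij_betw_same_card[OF this] show ?thesis by simp
  qed
  have "order G = (\<Sum>y \<in> f ` carrier G. card {g \<in> carrier G. f g = y})"
    using sum.image_gen[OF fin, of "\<lambda>_. 1::nat" f] by (simp add: order_def)
  also have "\<dots> = (\<Sum>y \<in> f ` carrier G. card {g \<in> carrier G. f g = f \<one>})"
    by (rule sum.cong[OF refl eq])
  finally show ?thesis by simp
qed

text \<open>The orbits partition \<open>E\<close>. The divisor \<open>k\<close> will be either a
  prime or the common size of all orbits.\<close>

lemma dvd_card_if_dvd_card_orbits:
  assumes fin: "finite E"
    and closed: "\<And>g x. g \<in> carrier G \<Longrightarrow> x \<in> E \<Longrightarrow> act g x \<in> E"
    and one: "\<And>x. x \<in> E \<Longrightarrow> act \<one> x = x"
    and mult: "\<And>g h x. g \<in> carrier G \<Longrightarrow> h \<in> carrier G \<Longrightarrow> x \<in> E \<Longrightarrow> act (g \<otimes> h) x = act g (act h x)"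
    and orb: "\<And>x. x \<in> E \<Longrightarrow> k dvd card ((\<lambda>g. act g x) ` carrier G)"
  shows "k dvd card E"
proof -
  let ?orb = "\<lambda>x. (\<lambda>g. act g x) ` carrier G"
  have sub: "?orb y \<subseteq> ?orb x" if "x \<in> E" "y \<in> ?orb x" for x y
    using that mult[symmetric] by auto
  have sym: "x \<in> ?orb y" if x: "x \<in> E" and y: "y \<in> ?orb x" for x y
  proof -
    obtain g where g: "g \<in> carrier G" "y = act g x" using y by blast
    have "act (inv g) y = x" using mult[of "inv g" g x] g x one by simp
    then show ?thesis using g by (intro image_eqI[of _ _ "inv g"]) auto
  qed
  have "\<Union> (?orb ` E) = E" using closed one by (force intro: image_eqI[of _ _ \<one>])
  moreover have "?orb x = ?orb y" if "x \<in> E" "y \<in> E" "z \<in> ?orb x" "z \<in> ?orb y" for x y z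
  proof -
    have "z \<in> E" using that closed by blast
    then have "?orb z = ?orb x" "?orb z = ?orb y"
      using sub[of x z] sub[of z x] sub[of y z] sub[of z y] sym[of x z] sym[of y z] that by blast+
    then show ?thesis by simp
  qed
  then have "\<forall>c1\<in>?orb ` E. \<forall>c2\<in>?orb ` E. c1 \<noteq> c2 \<longrightarrow> c1 \<inter> c2 = {}" by blast
  ultimately show ?thesis using dvd_partition[of "?orb ` E" k] fin orb by auto
qed

text \<open>Class equation: \<open>G\<close> acts by conjugation on its nonidentity elements. If
  none of them were central, \<open>p\<close> would divide all orbit sizes, hence both the order of
  \<open>G\<close> and that order minus 1.\<close>

lemma prime_power_order_imp_nontrivial_centre:
  assumes p: "Factorial_Ring.prime p" and ord: "order G = p ^ f" and f: "f > 0"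
  shows "\<exists>z \<in> carrier G. z \<noteq> \<one> \<and> (\<forall>x \<in> carrier G. z \<otimes> x = x \<otimes> z)"
proof (rule ccontr)
  assume no: "\<not> ?thesis"
  have fin: "finite (carrier G)"
    using ord p order_gt_0_iff_finite by (simp add: prime_gt_0_nat)
  let ?E = "carrier G - {\<one>}"
  have "p dvd card ?E"
  proof (rule dvd_card_if_dvd_card_orbits[where act = "\<lambda>g x. g \<otimes> x \<otimes> inv g"])
    fix g x assume "g \<in> carrier G" "x \<in> ?E"
    then show "g \<otimes> x \<otimes> inv g \<in> ?E"
      using inv_solve_right'[of \<one> "g \<otimes> x" g] by auto
  next
    fix g h x assume "g \<in> carrier G" "h \<in> carrier G" "x \<in> ?E"
    then show "g \<otimes> h \<otimes> x \<otimes> inv (g \<otimes> h) = g \<otimes> (h \<otimes> x \<otimes> inv h) \<otimes> inv g"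
      by (simp add: m_assoc inv_mult_group)
  next
    fix x assume x: "x \<in> ?E"
    let ?f = "\<lambda>g. g \<otimes> x \<otimes> inv g"
    have "order G = card (?f ` carrier G) * card {g \<in> carrier G. ?f g = ?f \<one>}"
    proof (rule card_eq_card_image_mult_fibre[OF fin])
      fix k g h assume c: "k \<in> carrier G" "g \<in> carrier G" "h \<in> carrier G" and eq: "?f g = ?f h"
      have "?f (k \<otimes> u) = k \<otimes> ?f u \<otimes> inv k" if "u \<in> carrier G" for u
        using that c x by (simp add: m_assoc inv_mult_group)
      then show "?f (k \<otimes> g) = ?f (k \<otimes> h)" using eq c by simp
    qed
    then have "card (?f ` carrier G) dvd p ^ f" using ord by simp
    then obtain i where i: "card (?f ` carrier G) = p ^ i" using divides_primepow_nat[OF p] by auto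
    \<comment> \<open>Orbit size \<open>p ^ 0\<close> would mean that \<open>x\<close> is its own
      only conjugate, a nontrivial central element against \<open>no\<close>.\<close>
    show "p dvd card (?f ` carrier G)"
    proof (cases i)
      case 0
      then obtain y where y: "?f ` carrier G = {y}" using i by (auto simp: card_1_singleton_iff)
      have fx: "?f \<one> = x" using x by simp
      have const: "?f g = x" if "g \<in> carrier G" for g
      proof -
        have "?f g \<in> {y}" "?f \<one> \<in> {y}" using that unfolding y[symmetric] by blast+
        then show ?thesis using fx by simp
      qed
      have "x \<otimes> g = g \<otimes> x" if g: "g \<in> carrier G" for g
        using const[OF g] g x inv_solve_right'[of x "g \<otimes> x" g] by simp
      then show ?thesis using no x by blast
    qed (use i in simp)
  qed (use fin in auto)
  moreover have "p dvd card (carrier G)" using ord f by (simp add: order_def)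
  moreover have "card (carrier G) = card ?E + 1" using fin by (metis Suc_eq_plus1 card_Suc_Diff1 one_closed)
  ultimately show False using p by (metis dvd_add_right_iff not_prime_unit)
qed

end

section \<open>Normal subgroups of characteristically simple groups\<close>

definition centraliser :: "('g, 'b) monoid_scheme \<Rightarrow> 'g set \<Rightarrow> 'g set" where
  "centraliser G S = {x \<in> carrier G. \<forall>y \<in> S. x \<otimes>\<^bsub>G\<^esub> y = y \<otimes>\<^bsub>G\<^esub> x}"

lemma centraliser_commute:
  "x \<in> centraliser G S \<Longrightarrow> y \<in> S \<Longrightarrow> x \<otimes>\<^bsub>G\<^esub> y = y \<otimes>\<^bsub>G\<^esub> x"
  unfolding centraliser_def by blast

lemma centraliser_closed: "x \<in> centraliser G S \<Longrightarrow> x \<in> carrier G"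
  unfolding centraliser_def by blast

context group
begin

lemma subgroup_centraliser:
  assumes S: "S \<subseteq> carrier G"
  shows "subgroup (centraliser G S) G"
proof (rule subgroupI)
  fix a assume a: "a \<in> centraliser G S"
  have "inv a \<otimes> y = y \<otimes> inv a" if y: "y \<in> S" for y
  proof -
    have c: "a \<in> carrier G" "y \<in> carrier G"
      using centraliser_closed[OF a] y S by auto
    have "inv a \<otimes> y = inv a \<otimes> (y \<otimes> a) \<otimes> inv a" using c by (simp add: m_assoc)
    also have "\<dots> = inv a \<otimes> (a \<otimes> y) \<otimes> inv a" using centraliser_commute[OF a y] by (simp only:)
    also have "\<dots> = y \<otimes> inv a" using c by (simp add: m_assoc[symmetric])
    finally show ?thesis .
  qed
  then show "inv a \<in> centraliser G S" using a by (simp add: centraliser_def)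
next
  fix a b assume ab: "a \<in> centraliser G S" "b \<in> centraliser G S"
  have "a \<otimes> b \<otimes> y = y \<otimes> (a \<otimes> b)" if y: "y \<in> S" for y
  proof -
    have c: "a \<in> carrier G" "b \<in> carrier G" "y \<in> carrier G"
      using ab y S centraliser_closed by auto
    have "a \<otimes> b \<otimes> y = a \<otimes> (b \<otimes> y)" using c by (simp add: m_assoc)
    also have "\<dots> = a \<otimes> (y \<otimes> b)" using centraliser_commute[OF ab(2) y] by (simp only:)
    also have "\<dots> = (a \<otimes> y) \<otimes> b" using c by (simp only: m_assoc)
    also have "\<dots> = (y \<otimes> a) \<otimes> b" using centraliser_commute[OF ab(1) y] by (simp only:)
    also have "\<dots> = y \<otimes> (a \<otimes> b)" using c by (simp add: m_assoc)
    finally show ?thesis .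
  qed
  then show "a \<otimes> b \<in> centraliser G S" using ab by (simp add: centraliser_def)
next
  have "\<one> \<in> centraliser G S" using S by (auto simp: centraliser_def)
  then show "centraliser G S \<noteq> {}" by blast
qed (auto simp: centraliser_def)

lemma normal_centraliser:
  assumes N: "N \<lhd> G"
  shows "centraliser G N \<lhd> G"
proof (rule normal_invI)
  have sub: "N \<subseteq> carrier G" using N by (simp add: normal_imp_subgroup subgroup.subset)
  then show "subgroup (centraliser G N) G" by (rule subgroup_centraliser)
  fix x h assume x: "x \<in> carrier G" and h: "h \<in> centraliser G N"
  have hc: "h \<in> carrier G" using h by (simp add: centraliser_def)
  have "x \<otimes> h \<otimes> inv x \<otimes> y = y \<otimes> (x \<otimes> h \<otimes> inv x)" if y: "y \<in> N" for y
  proof -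
    have yc: "y \<in> carrier G" using y sub by blast
    have "inv x \<otimes> y \<otimes> x \<in> N" using N x y by (rule normal.inv_op_closed1)
    then have "h \<otimes> (inv x \<otimes> y \<otimes> x) = (inv x \<otimes> y \<otimes> x) \<otimes> h" by (rule centraliser_commute[OF h])
    then have "x \<otimes> (h \<otimes> (inv x \<otimes> y \<otimes> x)) \<otimes> inv x = x \<otimes> ((inv x \<otimes> y \<otimes> x) \<otimes> h) \<otimes> inv x" by simp
    moreover have "x \<otimes> (h \<otimes> (inv x \<otimes> y \<otimes> x)) \<otimes> inv x = x \<otimes> h \<otimes> inv x \<otimes> y"
      using x hc yc by (simp add: m_assoc)
    moreover have "x \<otimes> ((inv x \<otimes> y \<otimes> x) \<otimes> h) \<otimes> inv x = (x \<otimes> inv x) \<otimes> (y \<otimes> (x \<otimes> h \<otimes> inv x))"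
      using x hc yc by (simp only: m_assoc inv_closed m_closed)
    ultimately show ?thesis using x hc yc by simp
  qed
  then show "x \<otimes> h \<otimes> inv x \<in> centraliser G N" using x hc by (simp add: centraliser_def)
qed

text \<open>By normality the commutator of an element of \<open>A\<close> with an element of
  \<open>B\<close> lies in both subgroups.\<close>

lemma normal_disjoint_subset_centraliser:
  assumes A: "A \<lhd> G" and B: "B \<lhd> G" and AB: "A \<inter> B = {\<one>}"
  shows "A \<subseteq> centraliser G B"
proof
  fix a assume a: "a \<in> A"
  have sA: "subgroup A G" and sB: "subgroup B G" using A B by (auto simp: normal_imp_subgroup)
  have ac: "a \<in> carrier G" using a sA subgroup.subset by blast
  have "a \<otimes> b = b \<otimes> a" if b: "b \<in> B" for b
  proof -
    have bc: "b \<in> carrier G" using b sB subgroup.subset by blast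
    have "a \<otimes> b \<otimes> inv a \<otimes> inv b \<in> B"
      using b ac B sB by (simp add: normal.inv_op_closed2 subgroup.m_closed subgroup.m_inv_closed)
    moreover have "a \<otimes> (b \<otimes> inv a \<otimes> inv b) \<in> A"
      using a bc A sA by (simp add: normal.inv_op_closed2 subgroup.m_closed subgroup.m_inv_closed)
    ultimately have "a \<otimes> b \<otimes> inv a \<otimes> inv b = \<one>" using AB ac bc by (auto simp: m_assoc)
    then have "a \<otimes> b \<otimes> inv (b \<otimes> a) = \<one>" using ac bc by (simp add: m_assoc inv_mult_group)
    then show ?thesis using ac bc by (metis inv_equality inv_inv m_closed inv_closed)
  qed
  then show "a \<in> centraliser G B" using ac by (simp add: centraliser_def)
qed

lemma exists_minimal_normal:
  assumes fin: "finite (carrier G)" and nt: "carrier G \<noteq> {\<one>}"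
  obtains M where "M \<lhd> G" "M \<noteq> {\<one>}" "\<And>N. N \<lhd> G \<Longrightarrow> N \<subseteq> M \<Longrightarrow> N = {\<one>} \<or> N = M"
proof -
  let ?P = "\<lambda>N. N \<lhd> G \<and> N \<noteq> {\<one>}"
  have "?P (carrier G)" using nt by (auto intro: normal_invI subgroup_self)
  then obtain M where M: "?P M" and min: "\<And>N. ?P N \<Longrightarrow> card M \<le> card N"
    using ex_has_least_nat[of ?P "carrier G" card] by blast
  have "M \<subseteq> carrier G" using M by (simp add: normal_imp_subgroup subgroup.subset)
  then have "finite M" using fin by (rule finite_subset)
  then have "N = {\<one>} \<or> N = M" if "N \<lhd> G" "N \<subseteq> M" for N
    using that min[of N] card_seteq by blast
  then show thesis using M that by blast
qed

lemma normal_vimage_auto: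
  assumes phi: "\<phi> \<in> auto G" and N: "N \<lhd> G"
  shows "{x \<in> carrier G. \<phi> x \<in> N} \<lhd> G"
proof -
  have hom: "group_hom G G \<phi>"
    using phi by (unfold_locales) (simp add: auto_def)
  then interpret h: group_hom G G \<phi> .
  have sN: "subgroup N G" using N by (rule normal_imp_subgroup)
  show ?thesis
  proof (rule normal_invI)
    show "subgroup {x \<in> carrier G. \<phi> x \<in> N} G"
      by (rule subgroupI) (use sN in \<open>auto simp: subgroup.m_closed subgroup.m_inv_closed subgroup.one_closed intro!: exI[of _ \<one>]\<close>)
  qed (use N in \<open>auto simp: normal.inv_op_closed2\<close>)
qed

text \<open>\<open>char_simple\<close> states invariance as an equality of sets; in a finite group
  an injective map of \<open>S\<close> into itself is onto, so an inclusion is enough.\<close>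

lemma invariant_if_image_subset:
  assumes fin: "finite (carrier G)" and S: "S \<subseteq> carrier G"
    and phi: "\<phi> \<in> auto G" and sub: "\<phi> ` S \<subseteq> S"
  shows "\<phi> ` S = S"
proof -
  have "inj_on \<phi> S"
    using phi S by (auto simp: auto_def Bij_def bij_betw_def intro: inj_on_subset)
  then show ?thesis
    using sub fin S by (simp add: card_image card_subset_eq finite_subset)
qed

end

text \<open>The centre is invariant under automorphisms, and \<open>nonab\<close> excludes that it
  is the whole group.\<close>

lemma char_simple_centre_trivial:
  assumes fin: "finite (carrier G)" and cs: "char_simple G"
    and nonab: "\<exists>x \<in> carrier G. \<exists>y \<in> carrier G. x \<otimes>\<^bsub>G\<^esub> y \<noteq> y \<otimes>\<^bsub>G\<^esub> x"
  shows "centraliser G (carrier G) = {\<one>\<^bsub>G\<^esub>}"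
proof -
  interpret group G using cs by (simp add: char_simple_def)
  let ?Z = "centraliser G (carrier G)"
  have sub: "subgroup ?Z G" by (rule subgroup_centraliser) simp
  have "\<phi> ` ?Z = ?Z" if phi: "\<phi> \<in> auto G" for \<phi>
  proof (rule invariant_if_image_subset[OF fin _ phi])
    show "?Z \<subseteq> carrier G" by (auto simp: centraliser_def)
    have hom: "\<phi> \<in> hom G G" and img: "\<phi> ` carrier G = carrier G"
      using phi by (auto simp: auto_def Bij_def bij_betw_def)
    show "\<phi> ` ?Z \<subseteq> ?Z"
    proof
      fix w assume "w \<in> \<phi> ` ?Z"
      then obtain z where z: "z \<in> ?Z" "w = \<phi> z" by blast
      have zc: "z \<in> carrier G" using z by (auto intro: centraliser_closed)
      have "w \<otimes>\<^bsub>G\<^esub> y = y \<otimes>\<^bsub>G\<^esub> w" if y: "y \<in> carrier G" for y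
      proof -
        obtain x where x: "x \<in> carrier G" "y = \<phi> x" using y img by blast
        have "z \<otimes>\<^bsub>G\<^esub> x = x \<otimes>\<^bsub>G\<^esub> z" using z(1) x(1) by (rule centraliser_commute)
        then show ?thesis using x z zc hom_mult[OF hom] by metis
      qed
      then show "w \<in> ?Z" using z zc hom by (auto simp: centraliser_def hom_def)
    qed
  qed
  then have "?Z = {\<one>\<^bsub>G\<^esub>} \<or> ?Z = carrier G" using cs sub by (simp add: char_simple_def)
  moreover have "?Z \<noteq> carrier G" using nonab by (auto simp: centraliser_def)
  ultimately show ?thesis by blast
qed

text \<open>The intersection of the subgroups \<open>N C(N)\<close>, over all normal \<open>N\<close>, is characteristic.
  It contains every minimal normal subgroup, because such a subgroup lies in \<open>N\<close> or meets
  it trivially and then centralises it.\<close>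

lemma char_simple_normal_mult_centraliser:
  assumes fin: "finite (carrier G)" and cs: "char_simple G"
    and N: "N \<lhd> G"
  shows "N <#>\<^bsub>G\<^esub> centraliser G N = carrier G"
proof -
  interpret group G using cs by (simp add: char_simple_def)
  define S where "S = (\<Inter>K \<in> {K. K \<lhd> G}. K <#>\<^bsub>G\<^esub> centraliser G K)"
  have subK: "subgroup (K <#>\<^bsub>G\<^esub> centraliser G K) G" if "K \<lhd> G" for K
    using that by (intro mult_norm_subgroup subgroup_centraliser)
      (simp_all add: normal_imp_subgroup subgroup.subset)
  have SN: "S \<subseteq> N <#>\<^bsub>G\<^esub> centraliser G N" using N by (auto simp: S_def)
  have sub: "subgroup S G"
    unfolding S_def using N subK by (intro subgroups_Inter) auto
  have Sc: "S \<subseteq> carrier G" using sub by (rule subgroup.subset)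
  have "\<phi> ` S = S" if phi: "\<phi> \<in> auto G" for \<phi>
  proof (rule invariant_if_image_subset[OF fin Sc phi])
    have hom: "\<phi> \<in> hom G G" and img: "\<phi> ` carrier G = carrier G"
      using phi by (auto simp: auto_def Bij_def bij_betw_def)
    show "\<phi> ` S \<subseteq> S"
    proof
      fix w assume "w \<in> \<phi> ` S"
      then obtain x where x: "x \<in> S" "w = \<phi> x" by blast
      have "w \<in> K <#>\<^bsub>G\<^esub> centraliser G K" if K: "K \<lhd> G" for K
      proof -
        \<comment> \<open>The automorphism maps the normal subgroup \<open>?L\<close> into
          \<open>K\<close>. Since every element of \<open>K\<close> has a preimage in
          \<open>?L\<close>, it also maps the centraliser of \<open>?L\<close> into that of
          \<open>K\<close>.\<close>
        let ?L = "{y \<in> carrier G. \<phi> y \<in> K}"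
        have "?L \<lhd> G" using phi K by (rule normal_vimage_auto)
        then have "x \<in> ?L <#>\<^bsub>G\<^esub> centraliser G ?L" using x by (auto simp: S_def)
        then obtain n c where n: "n \<in> ?L" and c: "c \<in> centraliser G ?L" and xnc: "x = n \<otimes>\<^bsub>G\<^esub> c"
          by (auto simp: set_mult_def)
        have cc: "c \<in> carrier G" using c by (rule centraliser_closed)
        have "\<phi> c \<otimes>\<^bsub>G\<^esub> k = k \<otimes>\<^bsub>G\<^esub> \<phi> c" if k: "k \<in> K" for k
        proof -
          have "k \<in> carrier G" using k K normal_imp_subgroup subgroup.subset by blast
          then obtain y where y: "y \<in> carrier G" "k = \<phi> y" using img by blast
          then have "c \<otimes>\<^bsub>G\<^esub> y = y \<otimes>\<^bsub>G\<^esub> c" using k by (intro centraliser_commute[OF c]) simp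
          then show ?thesis using y cc hom_mult[OF hom] by metis
        qed
        then have "\<phi> c \<in> centraliser G K" using cc hom by (auto simp: centraliser_def hom_def)
        moreover have "w = \<phi> n \<otimes>\<^bsub>G\<^esub> \<phi> c" using x xnc n cc hom_mult[OF hom] by simp
        ultimately show ?thesis using n by (auto simp: set_mult_def)
      qed
      then show "w \<in> S" by (auto simp: S_def)
    qed
  qed
  then have dich: "S = {\<one>\<^bsub>G\<^esub>} \<or> S = carrier G" using cs sub by (simp add: char_simple_def)
  \<comment> \<open>The trivial group is treated apart because it has no minimal normal
    subgroup.\<close>
  have "S = carrier G"
  proof (cases "carrier G = {\<one>\<^bsub>G\<^esub>}")
    case True
    then show ?thesis using dich by auto
  next
    case False
    then obtain M where M: "M \<lhd> G" "M \<noteq> {\<one>\<^bsub>G\<^esub>}"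
      and min: "\<And>N. N \<lhd> G \<Longrightarrow> N \<subseteq> M \<Longrightarrow> N = {\<one>\<^bsub>G\<^esub>} \<or> N = M"
      using exists_minimal_normal[OF fin] by blast
    have Mc: "M \<subseteq> carrier G" using M(1) normal_imp_subgroup subgroup.subset by blast
    have "M \<subseteq> K <#>\<^bsub>G\<^esub> centraliser G K" if K: "K \<lhd> G" for K
    proof -
      have sK: "subgroup K G" using K by (rule normal_imp_subgroup)
      have sC: "subgroup (centraliser G K) G"
        using sK by (intro subgroup_centraliser subgroup.subset)
      have "M \<inter> K = {\<one>\<^bsub>G\<^esub>} \<or> M \<inter> K = M"
        using min[of "M \<inter> K"] normal_subgroup_intersect[OF M(1) K] by simp
      then have "M \<subseteq> centraliser G K \<or> M \<subseteq> K"
        using normal_disjoint_subset_centraliser[OF M(1) K] by blast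
      then show ?thesis
      proof
        assume "M \<subseteq> centraliser G K"
        then show ?thesis using subgroup.one_closed[OF sK] Mc by (force simp: set_mult_def)
      next
        assume "M \<subseteq> K"
        then show ?thesis using subgroup.one_closed[OF sC] Mc by (force simp: set_mult_def)
      qed
    qed
    then have "M \<subseteq> S" by (auto simp: S_def)
    then have "S \<noteq> {\<one>\<^bsub>G\<^esub>}"
      using M(2) subgroup.one_closed[OF normal_imp_subgroup[OF M(1)]] by auto
    then show ?thesis using dich by blast
  qed
  then show ?thesis using SN subgroup.subset[OF subK[OF N]] by blast
qed

text \<open>An element of the intersection commutes with the centraliser because it lies in
  \<open>N\<close>, and with \<open>N\<close> because it lies in the centraliser; by
  \<open>fact\<close> it is central in \<open>G\<close>.\<close>

lemma (in group) normal_centre_trivial: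
  assumes Z: "centraliser G (carrier G) = {\<one>}"
    and N: "N \<lhd> G" and fact: "N <#> centraliser G N = carrier G"
  shows "N \<inter> centraliser G N = {\<one>}"
proof -
  have sN: "subgroup N G" using N by (rule normal_imp_subgroup)
  have sC: "subgroup (centraliser G N) G" using sN by (intro subgroup_centraliser subgroup.subset)
  have "z \<in> centraliser G (carrier G)" if z: "z \<in> N" "z \<in> centraliser G N" for z
  proof -
    have zc: "z \<in> carrier G" using z by (auto intro: centraliser_closed)
    have "z \<otimes> x = x \<otimes> z" if x: "x \<in> carrier G" for x
    proof -
      obtain n c where n: "n \<in> N" and c: "c \<in> centraliser G N" and xnc: "x = n \<otimes> c"
        using x unfolding fact[symmetric] set_mult_def by blast
      have nc: "n \<in> carrier G" and cc: "c \<in> carrier G"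
        using n subgroup.subset[OF sN] centraliser_closed[OF c] by auto
      have "z \<otimes> x = (z \<otimes> n) \<otimes> c" using xnc zc nc cc by (simp add: m_assoc)
      also have "\<dots> = (n \<otimes> z) \<otimes> c" using centraliser_commute[OF z(2) n] by (simp only:)
      also have "\<dots> = n \<otimes> (z \<otimes> c)" using zc nc cc by (simp add: m_assoc)
      also have "\<dots> = n \<otimes> (c \<otimes> z)" using centraliser_commute[OF c z(1)] by (simp only:)
      also have "\<dots> = x \<otimes> z" using xnc zc nc cc by (simp add: m_assoc)
      finally show ?thesis .
    qed
    then show ?thesis using zc by (simp add: centraliser_def)
  qed
  then show ?thesis using Z subgroup.one_closed[OF sN] subgroup.one_closed[OF sC] by blast
qed

section \<open>Transitive product actions\<close>

lemma (in group) normal_kernel_of_action: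
  assumes closed: "\<And>g x. g \<in> carrier G \<Longrightarrow> x \<in> E \<Longrightarrow> act g x \<in> E"
    and one: "\<And>x. x \<in> E \<Longrightarrow> act \<one> x = x"
    and mult: "\<And>g h x. g \<in> carrier G \<Longrightarrow> h \<in> carrier G \<Longrightarrow> x \<in> E \<Longrightarrow> act (g \<otimes> h) x = act g (act h x)"
  shows "{g \<in> carrier G. \<forall>x \<in> E. act g x = x} \<lhd> G" (is "?K \<lhd> G")
proof (rule normal_invI)
  have inv_act: "act (inv g) (act g x) = x" if "g \<in> carrier G" "x \<in> E" for g x
    using mult[of "inv g" g x] one that by simp
  show "subgroup ?K G"
  proof (rule subgroupI)
    have "\<one> \<in> ?K" using one by simp
    then show "?K \<noteq> {}" by blast
    fix a assume a: "a \<in> ?K"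
    then have "act (inv a) x = x" if "x \<in> E" for x using inv_act[of a x] that by simp
    then show "inv a \<in> ?K" using a by simp
  qed (use mult in auto)
  fix x h assume x: "x \<in> carrier G" and h: "h \<in> ?K"
  have "act (x \<otimes> h \<otimes> inv x) y = y" if y: "y \<in> E" for y
    using mult[of "x \<otimes> h" "inv x" y] mult[of x h "act (inv x) y"] inv_act[of "inv x" y]
      closed[of "inv x" y] x h y by simp
  then show "x \<otimes> h \<otimes> inv x \<in> ?K" using x h by simp
qed

text \<open>The element \<open>g\<close> sends \<open>\<omega>\<close> to the tuple whose \<open>\<beta> g i\<close>-th entry is \<open>\<alpha> g i (\<omega> i)\<close>;
  \<open>transitive\<close> refers to this product action on tuples.\<close>

locale product_action = group G for G (structure) +
  fixes I :: "'i set" and \<Gamma> :: "'c set"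
    and \<beta> :: "'a \<Rightarrow> 'i \<Rightarrow> 'i" and \<alpha> :: "'a \<Rightarrow> 'i \<Rightarrow> 'c \<Rightarrow> 'c"
  assumes finite_carrier: "finite (carrier G)"
    and finite_index: "finite I"
    and finite_component: "finite \<Gamma>"
    and index_closed: "g \<in> carrier G \<Longrightarrow> i \<in> I \<Longrightarrow> \<beta> g i \<in> I"
    and index_one: "i \<in> I \<Longrightarrow> \<beta> \<one> i = i"
    and index_mult: "g \<in> carrier G \<Longrightarrow> h \<in> carrier G \<Longrightarrow> i \<in> I \<Longrightarrow> \<beta> (g \<otimes> h) i = \<beta> g (\<beta> h i)"
    and comp_closed: "g \<in> carrier G \<Longrightarrow> i \<in> I \<Longrightarrow> \<gamma> \<in> \<Gamma> \<Longrightarrow> \<alpha> g i \<gamma> \<in> \<Gamma>"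
    and comp_one: "i \<in> I \<Longrightarrow> \<gamma> \<in> \<Gamma> \<Longrightarrow> \<alpha> \<one> i \<gamma> = \<gamma>"
    and comp_mult: "g \<in> carrier G \<Longrightarrow> h \<in> carrier G \<Longrightarrow> i \<in> I \<Longrightarrow> \<gamma> \<in> \<Gamma> \<Longrightarrow>
      \<alpha> (g \<otimes> h) i \<gamma> = \<alpha> g (\<beta> h i) (\<alpha> h i \<gamma>)"
    and transitive: "\<omega> \<in> I \<rightarrow> \<Gamma> \<Longrightarrow> \<omega>' \<in> I \<rightarrow> \<Gamma> \<Longrightarrow>
      \<exists>g \<in> carrier G. \<forall>i \<in> I. \<alpha> g i (\<omega> i) = \<omega>' (\<beta> g i)"
begin

lemma index_inv: "g \<in> carrier G \<Longrightarrow> i \<in> I \<Longrightarrow> \<beta> (inv g) (\<beta> g i) = i"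
  using index_mult[of "inv g" g i] index_one by simp

lemma index_inv': "g \<in> carrier G \<Longrightarrow> i \<in> I \<Longrightarrow> \<beta> g (\<beta> (inv g) i) = i"
  using index_inv[of "inv g" i] by simp

lemma comp_surj:
  assumes "g \<in> carrier G" "i \<in> I" "\<delta> \<in> \<Gamma>"
  obtains \<gamma> where "\<gamma> \<in> \<Gamma>" "\<delta> = \<alpha> g i \<gamma>"
proof
  let ?c = "\<alpha> (inv g) (\<beta> g i) \<delta>"
  show "?c \<in> \<Gamma>" using assms by (simp add: comp_closed index_closed)
  show "\<delta> = \<alpha> g i ?c"
    using comp_mult[of g "inv g" "\<beta> g i" \<delta>] assms by (simp add: index_inv index_closed comp_one)
qed

definition index_kernel :: "'a set" where
  "index_kernel = {g \<in> carrier G. \<forall>i \<in> I. \<beta> g i = i}"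

text \<open>This stands for the kernel on tuples: an element that fixes all pairs of a coordinate
  and a value fixes all tuples. Since \<open>G\<close> acts on the pairs, normality is an instance
  of the general kernel lemma.\<close>

definition pair_kernel :: "'a set" where
  "pair_kernel = {g \<in> carrier G. \<forall>x \<in> I \<times> \<Gamma>. (\<beta> g (fst x), \<alpha> g (fst x) (snd x)) = x}"

lemma normal_index_kernel: "index_kernel \<lhd> G"
  unfolding index_kernel_def
  by (rule normal_kernel_of_action) (auto simp: index_closed index_one index_mult)

lemma normal_pair_kernel: "pair_kernel \<lhd> G"
  unfolding pair_kernel_def
  by (rule normal_kernel_of_action)
    (auto simp: index_closed index_one index_mult comp_closed comp_one comp_mult)

lemma pair_kernelD:
  assumes "g \<in> pair_kernel" "i \<in> I" "\<gamma> \<in> \<Gamma>"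
  shows "\<beta> g i = i" "\<alpha> g i \<gamma> = \<gamma>"
  using assms by (force simp: pair_kernel_def)+

text \<open>The locale says nothing about \<open>\<beta> g\<close> outside \<open>I\<close>; the
  identity there yields a map that satisfies \<open>permutes\<close> and makes the assignment a
  homomorphism on \<open>G\<close>.\<close>

definition index_perm :: "'a \<Rightarrow> 'i \<Rightarrow> 'i" where
  "index_perm g = (\<lambda>i. if i \<in> I then \<beta> g i else i)"

lemma index_perm_permutes: "g \<in> carrier G \<Longrightarrow> index_perm g permutes I"
proof (rule bij_imp_permutes)
  assume g: "g \<in> carrier G"
  show "bij_betw (index_perm g) I I"
    by (rule bij_betw_byWitness[where f' = "index_perm (inv g)"])
      (use g in \<open>auto simp: index_perm_def index_closed index_inv index_inv'\<close>)
qed (simp add: index_perm_def)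

lemma index_perm_mult:
  "g \<in> carrier G \<Longrightarrow> h \<in> carrier G \<Longrightarrow> index_perm (g \<otimes> h) = index_perm g \<circ> index_perm h"
  by (auto simp: index_perm_def index_closed index_mult)

text \<open>Here \<open>k\<close> is the order of the permutation group that \<open>C\<close>
  induces on \<open>I\<close>.\<close>

lemma card_subgroup_index_perm:
  assumes C: "subgroup C G"
  shows "\<exists>k. k dvd fact (card I) \<and> card C = k * card (index_kernel \<inter> C)"
proof (intro exI conjI)
  let ?C = "G\<lparr>carrier := C\<rparr>"
  interpret C: group ?C using C by (rule subgroup_imp_group)
  have Cc: "C \<subseteq> carrier G" using C by (rule subgroup.subset)
  have one: "index_perm \<one> = id" by (auto simp: index_perm_def index_one)
  have "order ?C = card (index_perm ` carrier ?C)
      * card {g \<in> carrier ?C. index_perm g = index_perm \<one>\<^bsub>?C\<^esub>}"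
  proof (rule C.card_eq_card_image_mult_fibre)
    show "finite (carrier ?C)" using Cc finite_carrier finite_subset by simp
  qed (use Cc in \<open>auto simp: index_perm_mult subset_iff\<close>)
  moreover have "{g \<in> carrier ?C. index_perm g = index_perm \<one>\<^bsub>?C\<^esub>} = index_kernel \<inter> C"
    using Cc one by (auto simp: index_kernel_def index_perm_def fun_eq_iff split: if_splits)
  ultimately show "card C = card (index_perm ` C) * card (index_kernel \<inter> C)"
    by (simp add: order_def)
  \<comment> \<open>Lagrange's theorem for the induced group: it acts on all permutations of
    \<open>I\<close> by left composition, and each orbit has the size of the group because right
    composition with \<open>p\<close> is injective.\<close>
  have "card (index_perm ` C) dvd card {p. p permutes I}"
  proof (rule C.dvd_card_if_dvd_card_orbits[where act = "\<lambda>g p. index_perm g \<circ> p"])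
    fix p assume "p \<in> {p. p permutes I}"
    then have "surj p" by (simp add: permutes_surj)
    then have "inj_on (\<lambda>q. q \<circ> p) (index_perm ` C)"
      by (auto simp: inj_on_def fun_eq_iff surj_def) metis
    then have "card ((\<lambda>q. q \<circ> p) ` index_perm ` C) = card (index_perm ` C)" by (rule card_image)
    then show "card (index_perm ` C) dvd card ((\<lambda>g. index_perm g \<circ> p) ` carrier ?C)"
      by (simp add: image_image)
  qed (use Cc one index_perm_permutes in
      \<open>auto simp: finite_permutations finite_index permutes_compose index_perm_mult comp_assoc subset_iff\<close>)
  then show "card (index_perm ` C) dvd fact (card I)"
    by (simp add: card_permutations finite_index)
qed

text \<open>Orbit-stabiliser counting at a constant tuple, whose orbit under \<open>C\<close>
  consists of all tuples.\<close>

lemma card_tuples_dvd_card_transitive_subgroup: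
  assumes C: "subgroup C G" and ne: "\<Gamma> \<noteq> {}"
    and tr: "\<And>\<omega> \<omega>'. \<omega> \<in> I \<rightarrow> \<Gamma> \<Longrightarrow> \<omega>' \<in> I \<rightarrow> \<Gamma> \<Longrightarrow> \<exists>c \<in> C. \<forall>i \<in> I. \<alpha> c i (\<omega> i) = \<omega>' (\<beta> c i)"
  shows "card \<Gamma> ^ card I dvd card C"
proof -
  let ?C = "G\<lparr>carrier := C\<rparr>"
  interpret C: group ?C using C by (rule subgroup_imp_group)
  have Cc: "C \<subseteq> carrier G" using C by (rule subgroup.subset)
  obtain \<gamma> where \<gamma>: "\<gamma> \<in> \<Gamma>" using ne by blast
  \<comment> \<open>The value \<open>f c\<close> is the image under \<open>c\<close> of the constant
    tuple \<open>\<gamma>\<close>: its entry at \<open>j\<close> comes from the coordinate that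
    \<open>c\<close> sends to \<open>j\<close>.\<close>
  define f where "f = (\<lambda>c. \<lambda>j\<in>I. \<alpha> c (\<beta> (inv c) j) \<gamma>)"
  have "f (k \<otimes> g) = (\<lambda>j\<in>I. \<alpha> k (\<beta> (inv k) j) (f g (\<beta> (inv k) j)))"
    if "k \<in> carrier G" "g \<in> carrier G" for k g
    unfolding f_def
  proof (rule restrict_ext)
    fix j assume j: "j \<in> I"
    let ?j = "\<beta> (inv k) j"
    have "?j \<in> I" using that j by (simp add: index_closed)
    then show "\<alpha> (k \<otimes> g) (\<beta> (inv (k \<otimes> g)) j) \<gamma> = \<alpha> k ?j ((\<lambda>j\<in>I. \<alpha> g (\<beta> (inv g) j) \<gamma>) ?j)"
      using that j \<gamma> by (simp add: inv_mult_group index_mult comp_mult index_closed index_inv')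
  qed
  note f_mult = this
  have "order ?C = card (f ` carrier ?C) * card {g \<in> carrier ?C. f g = f \<one>\<^bsub>?C\<^esub>}"
  proof (rule C.card_eq_card_image_mult_fibre)
    show "finite (carrier ?C)" using Cc finite_carrier finite_subset by simp
  qed (use Cc in \<open>auto simp: f_mult subset_iff\<close>)
  moreover have "f ` C = PiE I (\<lambda>_. \<Gamma>)"
  proof
    show "f ` C \<subseteq> PiE I (\<lambda>_. \<Gamma>)"
      using Cc \<gamma> by (auto simp: f_def index_closed comp_closed subset_iff)
    show "PiE I (\<lambda>_. \<Gamma>) \<subseteq> f ` C"
    proof
      fix \<omega>' assume w: "\<omega>' \<in> PiE I (\<lambda>_. \<Gamma>)"
      then obtain c where c: "c \<in> C" and eq: "\<forall>i \<in> I. \<alpha> c i \<gamma> = \<omega>' (\<beta> c i)"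
        using tr[of "\<lambda>_. \<gamma>" \<omega>'] \<gamma> by auto
      have cc: "c \<in> carrier G" using c Cc by blast
      have "f c = \<omega>'"
      proof (rule extensionalityI[of _ I])
        show "\<omega>' \<in> extensional I" using w by (simp add: PiE_def)
      qed (use eq cc in \<open>auto simp: f_def index_closed index_inv'\<close>)
      then show "\<omega>' \<in> f ` C" using c by blast
    qed
  qed
  ultimately have "card C = card (PiE I (\<lambda>_. \<Gamma>)) * card {g \<in> C. f g = f \<one>}"
    by (simp add: order_def)
  then show ?thesis by (simp add: card_PiE finite_index)
qed

text \<open>The core of the argument. \<open>factor\<close> and \<open>centre\<close> are the two
  consequences of being characteristically simple and nonabelian on which it rests;
  \<open>index_trans\<close> is arranged later by passing to a single orbit of coordinates.\<close>

lemma index_transitive_imp_card_index_le_1: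
  assumes index_trans: "\<And>i j. i \<in> I \<Longrightarrow> j \<in> I \<Longrightarrow> \<exists>g \<in> carrier G. \<beta> g i = j"
    and card_comp: "card \<Gamma> \<ge> 2"
    and factor: "\<And>N. N \<lhd> G \<Longrightarrow> N <#> centraliser G N = carrier G"
    and centre: "centraliser G (carrier G) = {\<one>}"
  shows "card I \<le> 1"
proof (rule ccontr)
  assume "\<not> card I \<le> 1"
  then have card_index: "card I \<ge> 2" by simp
  have factorE: "\<exists>n \<in> N. \<exists>c \<in> centraliser G N. x = n \<otimes> c" if "N \<lhd> G" "x \<in> carrier G" for N x
    using that(2) unfolding factor[OF that(1), symmetric] set_mult_def by blast
  define C where "C = centraliser G pair_kernel"
  define P where "P = index_kernel \<inter> C"
  have nC: "C \<lhd> G" unfolding C_def by (rule normal_centraliser[OF normal_pair_kernel])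
  have nP: "P \<lhd> G" unfolding P_def by (rule normal_subgroup_intersect[OF normal_index_kernel nC])
  have sC: "subgroup C G" and sP: "subgroup P G" using nC nP by (auto simp: normal_imp_subgroup)
  have Cc: "c \<in> carrier G" if "c \<in> C" for c using that subgroup.subset[OF sC] by blast
  have Pc: "p \<in> carrier G" if "p \<in> P" for p using that subgroup.subset[OF sP] by blast
  have Pi: "\<beta> p i = i" if "p \<in> P" "i \<in> I" for p i using that by (simp add: P_def index_kernel_def)
  have kernel_C: "g = \<one>" if "g \<in> pair_kernel" "g \<in> C" for g
    using that normal_centre_trivial[OF centre normal_pair_kernel factor[OF normal_pair_kernel]]
    by (auto simp: C_def)

  \<comment> \<open>In \<open>g = n \<otimes> c\<close> the factor \<open>n\<close> acts trivially,
    so \<open>c\<close> moves the tuple exactly as \<open>g\<close> does.\<close>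
  have C_trans: "\<exists>c \<in> C. \<forall>i \<in> I. \<alpha> c i (\<omega> i) = \<omega>' (\<beta> c i)"
    if w: "\<omega> \<in> I \<rightarrow> \<Gamma>" "\<omega>' \<in> I \<rightarrow> \<Gamma>" for \<omega> \<omega>'
  proof -
    obtain g where g: "g \<in> carrier G" "\<forall>i \<in> I. \<alpha> g i (\<omega> i) = \<omega>' (\<beta> g i)"
      using transitive[OF w] by blast
    obtain n c where n: "n \<in> pair_kernel" and c: "c \<in> C" and gnc: "g = n \<otimes> c"
      using factorE[OF normal_pair_kernel g(1)] by (auto simp: C_def)
    have nc: "n \<in> carrier G" using n by (simp add: pair_kernel_def)
    have "\<alpha> c i (\<omega> i) = \<omega>' (\<beta> c i)" if i: "i \<in> I" for i
    proof -
      have wi: "\<omega> i \<in> \<Gamma>" using w i by auto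
      have "\<alpha> g i (\<omega> i) = \<alpha> c i (\<omega> i)"
        using gnc n nc Cc[OF c] i wi by (simp add: comp_mult pair_kernelD index_closed comp_closed)
      moreover have "\<beta> g i = \<beta> c i"
        using gnc n nc Cc[OF c] i wi by (simp add: index_mult pair_kernelD(1)[OF n _ wi] index_closed)
      ultimately show ?thesis using g i by metis
    qed
    then show ?thesis using c by blast
  qed

  \<comment> \<open>Now \<open>G\<close> is the product of \<open>P\<close> and its centraliser.
    Since \<open>P\<close> fixes every index, the factor from the centraliser already sends
    \<open>i\<close> to \<open>j\<close>.\<close>
  have P_comm_trans: "\<exists>l \<in> centraliser G P. \<beta> l i = j" if ij: "i \<in> I" "j \<in> I" for i j
  proof -
    obtain g where g: "g \<in> carrier G" "\<beta> g i = j" using index_trans[OF ij] by blast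
    obtain n l where n: "n \<in> P" and l: "l \<in> centraliser G P" and gnl: "g = n \<otimes> l"
      using factorE[OF nP g(1)] by blast
    have lc: "l \<in> carrier G" using l by (rule centraliser_closed)
    have "\<beta> g i = \<beta> l i" using gnl Pc[OF n] lc ij n by (simp add: index_mult Pi index_closed)
    then have "\<beta> l i = j" using g(2) by simp
    then show ?thesis using l by blast
  qed
  \<comment> \<open>An element \<open>l\<close> that commutes with \<open>P\<close> intertwines the
    action of \<open>P\<close> at coordinate \<open>i\<close> with its action at
    \<open>\<beta> l i\<close>.\<close>
  have comp_comm: "\<alpha> p (\<beta> l i) (\<alpha> l i \<gamma>) = \<alpha> l i (\<alpha> p i \<gamma>)"
    if l: "l \<in> centraliser G P" and p: "p \<in> P" and i: "i \<in> I" and \<gamma>: "\<gamma> \<in> \<Gamma>" for l p i \<gamma>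
  proof -
    have lc: "l \<in> carrier G" using l by (rule centraliser_closed)
    have "\<alpha> p (\<beta> l i) (\<alpha> l i \<gamma>) = \<alpha> (p \<otimes> l) i \<gamma>" using lc Pc[OF p] i \<gamma> by (simp add: comp_mult)
    also have "\<dots> = \<alpha> (l \<otimes> p) i \<gamma>" using centraliser_commute[OF l p] by (simp only:)
    also have "\<dots> = \<alpha> l i (\<alpha> p i \<gamma>)" using lc Pc[OF p] p i \<gamma> by (simp add: comp_mult Pi)
    finally show ?thesis .
  qed
  \<comment> \<open>Intertwining spreads trivial action from one coordinate to all, which puts
    \<open>p\<close> into both \<open>pair_kernel\<close> and its complement
    \<open>C\<close>.\<close>
  have faithful: "p = \<one>" if p: "p \<in> P" and i: "i \<in> I" and triv: "\<And>\<gamma>. \<gamma> \<in> \<Gamma> \<Longrightarrow> \<alpha> p i \<gamma> = \<gamma>" for p i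
  proof (rule kernel_C)
    have "\<alpha> p j \<delta> = \<delta>" if j: "j \<in> I" and \<delta>: "\<delta> \<in> \<Gamma>" for j \<delta>
    proof -
      obtain l where l: "l \<in> centraliser G P" "\<beta> l i = j" using P_comm_trans[OF i j] by blast
      obtain \<gamma> where "\<gamma> \<in> \<Gamma>" "\<delta> = \<alpha> l i \<gamma>"
        using comp_surj[OF centraliser_closed[OF l(1)] i \<delta>] by blast
      then show ?thesis using comp_comm[OF l(1) p i] l(2) triv by simp
    qed
    then show "p \<in> pair_kernel" using p Pi Pc by (auto simp: pair_kernel_def)
    show "p \<in> C" using p by (simp add: P_def)
  qed

  \<comment> \<open>Stabilisers in \<open>P\<close> of tuples are conjugate. Transporting \<open>\<gamma>\<close> to all coordinates by elements
     that centralise \<open>P\<close> gives a tuple whose stabiliser is that of \<open>\<gamma>\<close> in coordinate \<open>i\<close>; so it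
     is also the stabiliser of every other tuple through \<open>\<gamma>\<close>.\<close>
  have semiregular: "p = \<one>" if p: "p \<in> P" and i: "i \<in> I" and \<gamma>: "\<gamma> \<in> \<Gamma>" and pfix: "\<alpha> p i \<gamma> = \<gamma>" for p i \<gamma>
  proof -
    define stab where "stab = (\<lambda>\<omega>. {p \<in> P. \<forall>j \<in> I. \<alpha> p j (\<omega> j) = \<omega> j})"
    define S where "S = {p \<in> P. \<alpha> p i \<gamma> = \<gamma>}"
    have "finite P" using finite_carrier Pc by (meson finite_subset subsetI)
    then have finS: "finite S" by (simp add: S_def)
    obtain t where t: "\<And>j. j \<in> I \<Longrightarrow> t j \<in> centraliser G P \<and> \<beta> (t j) i = j"
      using P_comm_trans[OF i] by metis
    \<comment> \<open>The analogue of a diagonal tuple: \<open>t j\<close> transports coordinate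
      \<open>i\<close> to \<open>j\<close> and commutes with \<open>P\<close>, so whatever fixes
      \<open>\<gamma>\<close> at \<open>i\<close> fixes every entry.\<close>
    define \<omega> where "\<omega> = (\<lambda>j. \<alpha> (t j) i \<gamma>)"
    have w: "\<omega> \<in> I \<rightarrow> \<Gamma>"
      using t i \<gamma> by (auto simp: \<omega>_def intro!: comp_closed intro: centraliser_closed)
    have S_stab: "S \<subseteq> stab \<omega>"
    proof
      fix q assume q: "q \<in> S"
      then have "\<alpha> q j (\<omega> j) = \<omega> j" if "j \<in> I" for j
        using comp_comm[of "t j" q i \<gamma>] t[OF that] i \<gamma> by (simp add: S_def \<omega>_def)
      then show "q \<in> stab \<omega>" using q by (simp add: S_def stab_def)
    qed
    \<comment> \<open>Conjugation by \<open>g\<close> embeds \<open>stab \<omega>\<close> into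
      \<open>stab \<omega>'\<close>, which lies in \<open>S\<close>, which lies in
      \<open>stab \<omega>\<close>; the cardinalities force equality.\<close>
    have stab_eq: "stab \<omega>' = S" if w': "\<omega>' \<in> I \<rightarrow> \<Gamma>" and at_i: "\<omega>' i = \<gamma>" for \<omega>'
    proof (rule card_seteq[OF finS])
      show sub: "stab \<omega>' \<subseteq> S" using i at_i by (auto simp: stab_def S_def)
      obtain g where g: "g \<in> carrier G" and tr: "\<forall>j \<in> I. \<alpha> g j (\<omega> j) = \<omega>' (\<beta> g j)"
        using transitive[OF w w'] by blast
      let ?conj = "\<lambda>q. g \<otimes> q \<otimes> inv g"
      have "?conj ` stab \<omega> \<subseteq> stab \<omega>'"
      proof
        fix u assume "u \<in> ?conj ` stab \<omega>"
        then obtain q where q: "q \<in> stab \<omega>" and u: "u = ?conj q" by blast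
        have qP: "q \<in> P" using q by (simp add: stab_def)
        have uP: "u \<in> P" using u normal.inv_op_closed2[OF nP g qP] by simp
        have ug: "u \<otimes> g = g \<otimes> q" using u g Pc[OF qP] by (simp add: m_assoc)
        have "\<alpha> u k (\<omega>' k) = \<omega>' k" if k: "k \<in> I" for k
        proof -
          define j where "j = \<beta> (inv g) k"
          have j: "j \<in> I" "\<beta> g j = k" using g k by (auto simp: j_def index_closed index_inv')
          have wj: "\<omega> j \<in> \<Gamma>" using w j by auto
          have "\<alpha> u k (\<omega>' k) = \<alpha> (u \<otimes> g) j (\<omega> j)"
            using comp_mult[OF Pc[OF uP] g j(1) wj] tr j by simp
          also have "\<dots> = \<alpha> g j (\<alpha> q j (\<omega> j))"
            using comp_mult[OF g Pc[OF qP] j(1) wj] ug Pi[OF qP j(1)] by simp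
          also have "\<dots> = \<omega>' k" using q j tr by (simp add: stab_def)
          finally show ?thesis .
        qed
        then show "u \<in> stab \<omega>'" using uP by (simp add: stab_def)
      qed
      moreover have "inj_on ?conj (stab \<omega>)"
        using g Pc by (auto simp: inj_on_def stab_def)
      ultimately have "card (stab \<omega>) \<le> card (stab \<omega>')"
        using finite_subset[OF sub finS] by (intro card_inj_on_le)
      moreover have "finite (stab \<omega>)" using \<open>finite P\<close> by (simp add: stab_def)
      ultimately show "card S \<le> card (stab \<omega>')" using card_mono[OF _ S_stab] by linarith
    qed
    \<comment> \<open>At a second coordinate \<open>j\<close> the entry is free while coordinate
      \<open>i\<close> keeps \<open>\<gamma>\<close>. As \<open>p\<close> lies in \<open>S\<close>,
      it fixes every value at \<open>j\<close>, and faithfulness applies there.\<close>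
    have "card (I - {i}) \<noteq> 0" using card_index finite_index i by simp
    then have "I - {i} \<noteq> {}" by (metis card.empty)
    then obtain j where j: "j \<in> I" "j \<noteq> i" by blast
    show ?thesis
    proof (rule faithful[OF p j(1)])
      fix \<delta> assume "\<delta> \<in> \<Gamma>"
      then have "stab ((\<lambda>_. \<gamma>)(j := \<delta>)) = S" using \<gamma> j by (intro stab_eq) auto
      moreover have "p \<in> S" using p pfix by (simp add: S_def)
      ultimately have "p \<in> stab ((\<lambda>_. \<gamma>)(j := \<delta>))" by simp
      then have "\<alpha> p j (((\<lambda>_. \<gamma>)(j := \<delta>)) j) = ((\<lambda>_. \<gamma>)(j := \<delta>)) j"
        using j(1) unfolding stab_def by blast
      then show "\<alpha> p j \<delta> = \<delta>" by simp
    qed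
  qed

  interpret P: group "G\<lparr>carrier := P\<rparr>" using sP by (rule subgroup_imp_group)
  have "I \<noteq> {}" using card_index by auto
  then obtain i where i: "i \<in> I" by blast
  \<comment> \<open>By semiregularity every orbit of \<open>P\<close> on \<open>\<Gamma>\<close> at
    coordinate \<open>i\<close> has \<open>card P\<close> elements.\<close>
  have P_dvd: "card P dvd card \<Gamma>"
  proof (rule P.dvd_card_if_dvd_card_orbits[where act = "\<lambda>p. \<alpha> p i"])
    fix \<gamma> assume \<gamma>: "\<gamma> \<in> \<Gamma>"
    have "inj_on (\<lambda>p. \<alpha> p i \<gamma>) P"
    proof (rule inj_onI)
      fix p q assume pq: "p \<in> P" "q \<in> P" and eq: "\<alpha> p i \<gamma> = \<alpha> q i \<gamma>"
      have pqc: "p \<in> carrier G" "q \<in> carrier G" using pq Pc by auto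
      have "inv q \<otimes> p \<in> P" using pq sP by (simp add: subgroup.m_closed subgroup.m_inv_closed)
      moreover have "\<alpha> (inv q \<otimes> p) i \<gamma> = \<gamma>"
        using comp_mult[of "inv q" p i \<gamma>] comp_mult[of "inv q" q i \<gamma>] eq pq pqc i \<gamma>
        by (simp add: Pi comp_one)
      ultimately have "inv q \<otimes> p = \<one>" using semiregular i \<gamma> by blast
      then have "q \<otimes> (inv q \<otimes> p) = q" using pqc by simp
      then show "p = q" using pqc by (simp add: m_assoc[symmetric])
    qed
    then show "card P dvd card ((\<lambda>p. \<alpha> p i \<gamma>) ` carrier (G\<lparr>carrier := P\<rparr>))"
      by (simp add: card_image)
  qed (use i Pi Pc in \<open>auto simp: finite_component comp_closed comp_one comp_mult\<close>)
  obtain k where k: "k dvd fact (card I)" "card C = k * card P"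
    using card_subgroup_index_perm[OF sC] by (auto simp: P_def)
  have "card \<Gamma> ^ card I dvd card C"
    by (rule card_tuples_dvd_card_transitive_subgroup[OF sC _ C_trans]) (use card_comp in auto)
  also have "card C dvd fact (card I) * card P" using k by (simp add: mult_dvd_mono)
  finally obtain f where f: "f > 0" "card P = 2 ^ f"
    using power_dvd_fact_mult_imp_power_2[OF card_comp card_index _ P_dvd] by blast
  obtain z where z: "z \<in> P" "z \<noteq> \<one>" "\<forall>x \<in> P. z \<otimes> x = x \<otimes> z"
    using P.prime_power_order_imp_nontrivial_centre[OF two_is_prime_nat _ f(1)] f(2)
    by (auto simp: order_def)
  have "z \<in> centraliser G P" using z Pc unfolding centraliser_def by blast
  then have "z \<in> P \<inter> centraliser G P" using z(1) by blast
  then show False using z(2) normal_centre_trivial[OF centre nP factor[OF nP]] by blast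
qed

text \<open>The group stays the same and only the set of coordinates shrinks, so hypotheses on the
  group carry over unchanged.\<close>

lemma product_action_orbit:
  assumes i: "i \<in> I" and ne: "\<Gamma> \<noteq> {}"
  shows "product_action G ((\<lambda>g. \<beta> g i) ` carrier G) \<Gamma> \<beta> \<alpha>"
proof -
  let ?D = "(\<lambda>g. \<beta> g i) ` carrier G"
  have D: "j \<in> I" if "j \<in> ?D" for j using that i index_closed by blast
  obtain \<gamma> where \<gamma>: "\<gamma> \<in> \<Gamma>" using ne by blast
  have closed: "\<beta> g j \<in> ?D" if g: "g \<in> carrier G" and j: "j \<in> ?D" for g j
  proof -
    obtain h where h: "h \<in> carrier G" "j = \<beta> h i" using j by blast
    then have "\<beta> g j = \<beta> (g \<otimes> h) i" using g i by (simp add: index_mult)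
    then show ?thesis using g h by blast
  qed
  have trans: "\<exists>g \<in> carrier G. \<forall>j \<in> ?D. \<alpha> g j (\<omega> j) = \<omega>' (\<beta> g j)"
    if w: "\<omega> \<in> ?D \<rightarrow> \<Gamma>" "\<omega>' \<in> ?D \<rightarrow> \<Gamma>" for \<omega> \<omega>'
  proof -
    \<comment> \<open>The default \<open>\<gamma>\<close> only completes a tuple on the orbit to one
      on \<open>I\<close>; the orbit is invariant, so this filler does not affect the entries on
      it.\<close>
    define ext where "ext = (\<lambda>\<omega> j. if j \<in> ?D then \<omega> j else \<gamma>)"
    have "ext \<omega> \<in> I \<rightarrow> \<Gamma>" "ext \<omega>' \<in> I \<rightarrow> \<Gamma>"
      using w \<gamma> by (auto simp: ext_def Pi_iff)
    then obtain g where g: "g \<in> carrier G" "\<forall>j \<in> I. \<alpha> g j (ext \<omega> j) = ext \<omega>' (\<beta> g j)"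
      using transitive by blast
    have "\<alpha> g j (\<omega> j) = \<omega>' (\<beta> g j)" if j: "j \<in> ?D" for j
      using g(2) D[OF j] j closed[OF g(1) j] unfolding ext_def by metis
    then show ?thesis using g(1) by blast
  qed
  show ?thesis
    by unfold_locales
      (use D closed trans in
        \<open>simp_all add: finite_carrier finite_component index_one index_mult comp_closed comp_one comp_mult\<close>)
qed

end

text \<open>Applied to the orbit of \<open>i\<close>, the core lemma leaves room for one coordinate
  only, and the orbit contains both \<open>i\<close> and \<open>\<beta> g i\<close>.\<close>

lemma (in product_action) index_action_trivial:
  assumes cs: "char_simple G"
    and nonab: "\<exists>x \<in> carrier G. \<exists>y \<in> carrier G. x \<otimes> y \<noteq> y \<otimes> x"
    and card_comp: "card \<Gamma> \<ge> 2"
    and g: "g \<in> carrier G" and i: "i \<in> I"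
  shows "\<beta> g i = i"
proof -
  let ?D = "(\<lambda>g. \<beta> g i) ` carrier G"
  have "\<Gamma> \<noteq> {}" using card_comp by auto
  then interpret D: product_action G ?D \<Gamma> \<beta> \<alpha> using i by (intro product_action_orbit)
  have "card ?D \<le> 1"
  proof (rule D.index_transitive_imp_card_index_le_1)
    fix j k assume "j \<in> ?D" "k \<in> ?D"
    then obtain g h where gh: "g \<in> carrier G" "j = \<beta> g i" "h \<in> carrier G" "k = \<beta> h i" by blast
    then have "\<beta> (h \<otimes> inv g) j = k" using i by (simp add: index_mult index_inv index_closed)
    then show "\<exists>x \<in> carrier G. \<beta> x j = k" using gh by blast
  qed (use card_comp char_simple_normal_mult_centraliser[OF finite_carrier cs]
      char_simple_centre_trivial[OF finite_carrier cs nonab] in auto)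
  moreover have "\<beta> g i \<in> ?D" using g by blast
  moreover have "i \<in> ?D" using index_one[OF i] by (metis image_eqI one_closed)
  ultimately show ?thesis using card_le_Suc0_iff_eq[OF D.finite_index] unfolding One_nat_def by blast
qed

section \<open>Wreath products in product action\<close>

text \<open>Reading the image at \<open>b i\<close> removes the inverse from the product action and
  gives the form used in the locale \<open>product_action\<close>.\<close>

lemma prod_act_apply:
  assumes "b permutes {..<r}" "\<omega> \<in> Omega \<Gamma> r" "i < r"
  shows "prod_act \<Gamma> r a b \<omega> (b i) = a i (\<omega> i)"
proof -
  have "b i < r" using assms permutes_in_image[of b "{..<r}" i] by simp
  then show ?thesis using assms by (simp add: prod_act_def permutes_inverses)
qed

text \<open>If two coordinates of the image both depended on \<open>\<omega> i\<close> only, the first would determine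
  \<open>\<omega> i\<close>, and hence the second.\<close>

lemma dependent_coordinate_unique:
  assumes card: "card \<Gamma> \<ge> 2"
    and surj: "F ` Omega \<Gamma> r = Omega \<Gamma> r"
    and i: "i < r" and j: "j < r" and k: "k < r"
    and inj: "inj_on u \<Gamma>"
    and u: "\<And>\<omega>. \<omega> \<in> Omega \<Gamma> r \<Longrightarrow> F \<omega> j = u (\<omega> i)"
    and v: "\<And>\<omega>. \<omega> \<in> Omega \<Gamma> r \<Longrightarrow> F \<omega> k = v (\<omega> i)"
  shows "j = k"
proof (rule ccontr)
  assume jk: "j \<noteq> k"
  obtain x y where xy: "x \<in> \<Gamma>" "y \<in> \<Gamma>" "x \<noteq> y"
    using obtain_subset_with_card_n[OF card] by (metis card_2_iff insert_subset)
  \<comment> \<open>For different \<open>z\<close> these tuples agree at \<open>j\<close> and differ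
    at \<open>k\<close>.\<close>
  define T where "T = (\<lambda>z. \<lambda>l\<in>{..<r}. if l = k then z else x)"
  have T: "T z \<in> F ` Omega \<Gamma> r" if "z \<in> \<Gamma>" for z
    unfolding surj using that xy by (auto simp: T_def Omega_def)
  obtain s where s: "s \<in> Omega \<Gamma> r" "T x = F s" using T[OF xy(1)] by blast
  obtain t where t: "t \<in> Omega \<Gamma> r" "T y = F t" using T[OF xy(2)] by blast
  have "u (s i) = u (t i)"
    using u[OF s(1)] u[OF t(1)] s(2)[symmetric] t(2)[symmetric] j jk by (simp add: T_def)
  then have "s i = t i" using inj s(1) t(1) i by (auto simp: inj_on_def Omega_def)
  then have "T x k = T y k" using v[OF s(1)] v[OF t(1)] s(2) t(2) by simp
  then show False using xy k by (simp add: T_def)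
qed

theorem theorem1p1:
  fixes \<Gamma> :: "'a set" and r :: nat and H :: "((nat \<Rightarrow> 'a) \<Rightarrow> (nat \<Rightarrow> 'a)) set"
  assumes "finite \<Gamma>" and "card \<Gamma> \<ge> 2" and "r \<ge> 2"
    and "subgroup H (BijGroup (Omega \<Gamma> r))"
    and "H \<subseteq> wreath_prod \<Gamma> r"
    and "\<forall>x \<in> Omega \<Gamma> r. \<forall>y \<in> Omega \<Gamma> r. \<exists>h \<in> H. h x = y"
    and "\<exists>g \<in> H. \<exists>h \<in> H. g \<otimes>\<^bsub>BijGroup (Omega \<Gamma> r)\<^esub> h \<noteq> h \<otimes>\<^bsub>BijGroup (Omega \<Gamma> r)\<^esub> g"
    and "char_simple ((BijGroup (Omega \<Gamma> r))\<lparr>carrier := H\<rparr>)"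
  shows "H \<subseteq> base_group \<Gamma> r"
proof -
  let ?O = "Omega \<Gamma> r"
  let ?G = "(BijGroup ?O)\<lparr>carrier := H\<rparr>"
  have H: "subgroup H (BijGroup ?O)" by fact
  have HBij: "h \<in> Bij ?O" if "h \<in> H" for h
    using subgroup.subset[OF H] that by (auto simp: BijGroup_def)
  have img: "h ` ?O = ?O" if "h \<in> H" for h
    using HBij[OF that] by (auto simp: Bij_def bij_betw_def)
  have finH: "finite H"
  proof (rule finite_subset)
    show "H \<subseteq> PiE ?O (\<lambda>_. ?O)" using HBij by (auto simp: PiE_def Bij_def bij_betw_def)
    show "finite (PiE ?O (\<lambda>_. ?O))" using assms(1) by (auto simp: Omega_def intro!: finite_PiE)
  qed
  \<comment> \<open>\<open>H\<close> consists of permutations of the tuples, so a pair of component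
    maps and index permutation is merely chosen for each element. That the choices respect products
    has to be proved.\<close>
  have "\<forall>h \<in> H. \<exists>ab. (\<forall>i<r. fst ab i permutes \<Gamma>) \<and> snd ab permutes {..<r} \<and> h = prod_act \<Gamma> r (fst ab) (snd ab)"
    using assms(5) by (fastforce simp: wreath_prod_def)
  then obtain ab where ab: "\<And>h. h \<in> H \<Longrightarrow> (\<forall>i<r. fst (ab h) i permutes \<Gamma>) \<and>
      snd (ab h) permutes {..<r} \<and> h = prod_act \<Gamma> r (fst (ab h)) (snd (ab h))"
    by metis
  define \<alpha> where "\<alpha> = (\<lambda>h. fst (ab h))"
  define \<beta> where "\<beta> = (\<lambda>h. snd (ab h))"
  have alpha: "\<alpha> h i permutes \<Gamma>" if "h \<in> H" "i < r" for h i using ab that by (simp add: \<alpha>_def)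
  have beta: "\<beta> h permutes {..<r}" if "h \<in> H" for h using ab that by (simp add: \<beta>_def)
  have eq: "h = prod_act \<Gamma> r (\<alpha> h) (\<beta> h)" if "h \<in> H" for h using ab that by (simp add: \<alpha>_def \<beta>_def)
  have act_at: "h \<omega> (\<beta> h i) = \<alpha> h i (\<omega> i)" if "h \<in> H" "\<omega> \<in> ?O" "i < r" for h \<omega> i
    using prod_act_apply[OF beta[OF that(1)] that(2,3), of "\<alpha> h"] unfolding eq[OF that(1), symmetric] .
  have beta_lt: "\<beta> h i < r" if "h \<in> H" "i < r" for h i
    using permutes_in_image[OF beta[OF that(1)], of i] that by simp
  have beta_inj: "\<beta> h i = \<beta> h j \<Longrightarrow> i = j" if "h \<in> H" for h i j
    using permutes_inj[OF beta[OF that]] by (rule injD)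
  have alpha_inj: "\<alpha> h i x = \<alpha> h i y \<Longrightarrow> x = y" if "h \<in> H" "i < r" for h i x y
    using permutes_inj[OF alpha[OF that]] by (rule injD)
  have alpha_in: "\<alpha> h i x \<in> \<Gamma>" if "h \<in> H" "i < r" "x \<in> \<Gamma>" for h i x
    using permutes_in_image[OF alpha[OF that(1,2)], of x] that by simp
  have point: "\<exists>\<omega> \<in> ?O. \<omega> i = x" if "i < r" "x \<in> \<Gamma>" for i x
    using that by (intro bexI[of _ "\<lambda>_\<in>{..<r}. x"]) (auto simp: Omega_def)
  have mult: "g \<otimes>\<^bsub>?G\<^esub> h = compose ?O g h" if "g \<in> H" "h \<in> H" for g h
    using HBij that by (simp add: BijGroup_def)
  have mult_closed: "compose ?O g h \<in> H" if "g \<in> H" "h \<in> H" for g h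
    using subgroup.m_closed[OF H that] mult[OF that] by simp
  interpret G: group ?G using assms(8) by (simp add: char_simple_def)
  have one: "\<one>\<^bsub>?G\<^esub> \<in> H" using G.one_closed by simp
  have comp: "compose ?O g h \<omega> (\<beta> g (\<beta> h i)) = \<alpha> g (\<beta> h i) (\<alpha> h i (\<omega> i))"
    if "g \<in> H" "h \<in> H" "\<omega> \<in> ?O" "i < r" for g h \<omega> i
  proof -
    have "h \<omega> \<in> ?O" using img[OF that(2)] that(3) by blast
    then show ?thesis
      using act_at[OF that(1), of "h \<omega>" "\<beta> h i"] act_at[OF that(2-4)] beta_lt[OF that(2,4)] that(3)
      by (simp add: compose_def)
  qed
  \<comment> \<open>Both indices are coordinates of the image that depend on
    \<open>\<omega> i\<close> alone, one by the pair chosen for the product and one by composing the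
    pairs of the factors.\<close>
  have beta_mult: "\<beta> (compose ?O g h) i = \<beta> g (\<beta> h i)" if gh: "g \<in> H" "h \<in> H" and i: "i < r" for g h i
  proof (rule dependent_coordinate_unique[OF assms(2) img[OF mult_closed[OF gh]] i])
    show "inj_on (\<alpha> (compose ?O g h) i) \<Gamma>"
      using alpha_inj[OF mult_closed[OF gh] i] by (rule inj_onI)
  next
    fix \<omega> assume w: "\<omega> \<in> ?O"
    show "compose ?O g h \<omega> (\<beta> (compose ?O g h) i) = \<alpha> (compose ?O g h) i (\<omega> i)"
      by (rule act_at[OF mult_closed[OF gh] w i])
    show "compose ?O g h \<omega> (\<beta> g (\<beta> h i)) = (\<lambda>x. \<alpha> g (\<beta> h i) (\<alpha> h i x)) (\<omega> i)"
      using comp[OF gh w i] .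
  qed (use gh i beta_lt mult_closed in auto)
  have alpha_mult: "\<alpha> (compose ?O g h) i x = \<alpha> g (\<beta> h i) (\<alpha> h i x)"
    if gh: "g \<in> H" "h \<in> H" and i: "i < r" and x: "x \<in> \<Gamma>" for g h i x
  proof -
    obtain \<omega> where w: "\<omega> \<in> ?O" "\<omega> i = x" using point[OF i x] by blast
    show ?thesis
      using comp[OF gh w(1) i] act_at[OF mult_closed[OF gh] w(1) i] beta_mult[OF gh i] w(2) by simp
  qed
  have one_one: "compose ?O \<one>\<^bsub>?G\<^esub> \<one>\<^bsub>?G\<^esub> = \<one>\<^bsub>?G\<^esub>"
    using mult[OF one one] G.l_one[of "\<one>\<^bsub>?G\<^esub>"] one by simp
  \<comment> \<open>\<open>\<beta>\<close> at the identity is idempotent by \<open>beta_mult\<close>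
    and injective; the same argument serves for \<open>\<alpha>\<close> below.\<close>
  have beta_one: "\<beta> \<one>\<^bsub>?G\<^esub> i = i" if i: "i < r" for i
    using beta_mult[OF one one i] beta_inj[OF one] unfolding one_one by metis
  interpret product_action ?G "{..<r}" \<Gamma> \<beta> \<alpha>
  proof unfold_locales
    fix i x assume "i \<in> {..<r}" and x: "x \<in> \<Gamma>"
    then have i: "i < r" by simp
    have "\<alpha> \<one>\<^bsub>?G\<^esub> i (\<alpha> \<one>\<^bsub>?G\<^esub> i x) = \<alpha> \<one>\<^bsub>?G\<^esub> i x"
      using alpha_mult[OF one one i x, symmetric] unfolding one_one beta_one[OF i] .
    then show "\<alpha> \<one>\<^bsub>?G\<^esub> i x = x" by (rule alpha_inj[OF one i])
  next
    fix \<omega> \<omega>' :: "nat \<Rightarrow> 'a" assume w: "\<omega> \<in> {..<r} \<rightarrow> \<Gamma>" "\<omega>' \<in> {..<r} \<rightarrow> \<Gamma>"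
    \<comment> \<open>Members of \<open>Omega\<close> are extensional, whereas the tuples of the
      locale are arbitrary outside the index set.\<close>
    have O: "restrict \<omega> {..<r} \<in> ?O" "restrict \<omega>' {..<r} \<in> ?O" using w by (auto simp: Omega_def)
    then obtain h where h: "h \<in> H" "h (restrict \<omega> {..<r}) = restrict \<omega>' {..<r}"
      using assms(6) by blast
    have "\<alpha> h i (\<omega> i) = \<omega>' (\<beta> h i)" if "i < r" for i
      using act_at[OF h(1) O(1) that] h(2) beta_lt[OF h(1) that] that by simp
    then show "\<exists>g\<in>carrier ?G. \<forall>i\<in>{..<r}. \<alpha> g i (\<omega> i) = \<omega>' (\<beta> g i)" using h(1) by auto
  qed (use assms(1) finH beta_lt beta_one alpha_in beta_mult alpha_mult mult in simp_all)
  show ?thesis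
  proof
    fix h assume h: "h \<in> H"
    have "\<beta> h i = i" for i
    proof (cases "i < r")
      case True
      then show ?thesis
        using index_action_trivial[OF assms(8), of h i] assms(2,7) h by simp
    next
      case False
      then show ?thesis using permutes_not_in[OF beta[OF h]] by simp
    qed
    then have id: "\<beta> h = id" by auto
    have "h = prod_act \<Gamma> r (\<alpha> h) id" using eq[OF h] unfolding id .
    then show "h \<in> base_group \<Gamma> r" using alpha[OF h] unfolding base_group_def by blast
  qed
qed

end
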